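(* For any $k \in \mathbb N$ and any $\gamma >0$, there exists $n_0\in \mathbb N$ such that the following holds. Suppose that $n \geq n_0$ and let $C$ be a directed cycle of length $\lceil\frac{n}{k+1}\rceil<|C|\leq \lceil\frac{n}{k}\rceil$. If $G$ is a digraph on $n$ vertices with $\delta(G)\geq \left(1+\frac{1}{k+1}+\gamma \right)n$, then $G$ contains $C$. On the other hand, for every $n\geq k+1$ and every directed cycle $C$ of length $\lceil\frac{n}{k+1}\rceil<|C|\leq \lceil\frac{n}{k}\rceil$, there is an $n$-vertex digraph $G_1$ with $\delta(G_1)= n+ \lfloor\frac{n}{k+1}\rfloor-2$ that does not contain $C$.
   Context: Digraphs have no loops and at most one edge in each direction between any pair of vertices (so both $xy$ and $yx$ may be present). The minimum degree $\delta(G)$ of a digraph $G$ is the minimum, over the vertices $v$, of the number of edges incident to $v$ (in-degree plus out-degree). An oriented graph is a digraph with at most one edge between any pair of vertices. A directed cycle is an oriented graph whose underlying graph is a cycle (so it has at least $3$ vertices) and all of whose edges are oriented in the same direction around the cycle; $|C|$ is its number of vertices. Containment means as a (not necessarily induced) subdigraph. $\mathbb N$ denotes the positive integers. *)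

theory Defs
  imports Complex_Main "Graph_Theory.Graph_Theory"
begin

text \<open>The digraphs of the paper are those of the locale \<^locale>\<open>digraph\<close>: finite, without loops,
  and with at most one arc in each direction between two vertices.\<close>

text \<open>Only meaningful for digraphs with a nonempty finite vertex set.\<close>
definition min_degree :: "('a, 'b) pre_digraph \<Rightarrow> nat" where
  "min_degree G = Min ((\<lambda>v. in_degree G v + out_degree G v) ` verts G)"

text \<open>The library notion of cycle is a closed arc walk and allows length 2; a directed cycle is a
  whole digraph consisting of the vertices and arcs of such a walk, with at least 3 vertices.\<close>
definition directed_cycle :: "('a, 'b) pre_digraph \<Rightarrow> bool" where
  "directed_cycle C \<longleftrightarrow> digraph C \<and> card (verts C) \<ge> 3 \<and>
     (\<exists>p. pre_digraph.cycle C p \<and> arcs C = set p \<and> verts C = tail C ` set p)"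

text \<open>Containment is up to isomorphism, and the copy need not be induced or spanning.\<close>
definition contains_digraph :: "('a, 'b) pre_digraph \<Rightarrow> ('c, 'd) pre_digraph \<Rightarrow> bool" where
  "contains_digraph G H \<longleftrightarrow> (\<exists>H'. subgraph H' G \<and> digraph_iso H H')"

end

theory Submission
  imports Defs
begin

text \<open>In each strong component K, every vertex sends or receives at most one arc to or from each vertex
  outside K. The degree condition therefore forces |K| to exceed n/(k+1), so there are at most k strong
  components and one of them, K, has at least n/k vertices. Inside K the minimum degree still exceeds
  |K|. Such a strong digraph is pancyclic (Haggkvist and Thomassen): some vertex v can be deleted
  without destroying strongness, K - v has a Hamilton cycle by the theorem of Ghouila-Houri, and v has
  more than |K| - 1 arcs to and from that cycle, hence closes up a segment of any prescribed length.

  For the lower bound, take complete digraphs on the residue classes modulo k+1 and all arcs from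
  smaller to larger residues: a cycle cannot leave its class.\<close>

section \<open>Degrees, paths and cycles of a relation\<close>

text \<open>\<open>v\<close> may lie outside \<open>A\<close>, so that degrees add up over a
  partition of the vertex set.\<close>

definition deg_in :: "('a \<times> 'a) set \<Rightarrow> 'a set \<Rightarrow> 'a \<Rightarrow> nat" where
  "deg_in r A v = card {w \<in> A. (v, w) \<in> r} + card {w \<in> A. (w, v) \<in> r}"

text \<open>\<open>Restr\<close> keeps the connecting walks inside \<open>A\<close>; every singleton
  is strong.\<close>

definition strong_on :: "('a \<times> 'a) set \<Rightarrow> 'a set \<Rightarrow> bool" where
  "strong_on r A \<longleftrightarrow> (\<forall>u\<in>A. \<forall>v\<in>A. (u, v) \<in> (Restr r A)\<^sup>*)"

definition dpath :: "('a \<times> 'a) set \<Rightarrow> 'a list \<Rightarrow> bool" where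
  "dpath r xs \<longleftrightarrow> distinct xs \<and> successively (\<lambda>u v. (u, v) \<in> r) xs"

text \<open>A single vertex counts as a (trivial) cycle of length 1.\<close>
definition dcycle :: "('a \<times> 'a) set \<Rightarrow> 'a list \<Rightarrow> bool" where
  "dcycle r xs \<longleftrightarrow> xs \<noteq> [] \<and> dpath r xs \<and> (length xs = 1 \<or> (last xs, hd xs) \<in> r)"

lemma deg_in_Un:
  assumes "finite A" "finite B" "A \<inter> B = {}"
  shows "deg_in r (A \<union> B) v = deg_in r A v + deg_in r B v"
proof -
  have "card {w \<in> A \<union> B. P w} = card {w \<in> A. P w} + card {w \<in> B. P w}" for P
  proof -
    have "{w \<in> A \<union> B. P w} = {w \<in> A. P w} \<union> {w \<in> B. P w}" by auto
    then show ?thesis using assms by (simp add: card_Un_disjoint disjoint_iff)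
  qed
  then show ?thesis by (simp add: deg_in_def)
qed

lemma deg_in_le_double_card: "finite A \<Longrightarrow> deg_in r A v \<le> 2 * card A"
  unfolding deg_in_def
  using card_mono[of A "{w \<in> A. (v, w) \<in> r}"] card_mono[of A "{w \<in> A. (w, v) \<in> r}"] by auto

lemma deg_in_remove:
  assumes "(v, v) \<notin> r"
  shows "deg_in r (A - {v}) v = deg_in r A v"
proof -
  have "{w \<in> A - {v}. (v, w) \<in> r} = {w \<in> A. (v, w) \<in> r}" "{w \<in> A - {v}. (w, v) \<in> r} = {w \<in> A. (w, v) \<in> r}"
    using assms by auto
  then show ?thesis by (simp add: deg_in_def)
qed

lemma deg_in_insert:
  assumes "finite A" "x \<notin> A"
  shows "deg_in r (insert x A) v
    = deg_in r A v + (if (v, x) \<in> r then 1 else 0) + (if (x, v) \<in> r then 1 else 0)"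
proof -
  have "deg_in r ({x} \<union> A) v = deg_in r {x} v + deg_in r A v"
    using assms by (intro deg_in_Un) auto
  moreover have "{w \<in> {x}. P w} = (if P x then {x} else {})" for P by auto
  then have "deg_in r {x} v = (if (v, x) \<in> r then 1 else 0) + (if (x, v) \<in> r then 1 else 0)"
    by (simp add: deg_in_def)
  ultimately show ?thesis by simp
qed

text \<open>No room for \<open>v\<close> between consecutive \<open>a\<close>, \<open>b\<close>
  means that at most one of the arcs \<open>(a, v)\<close>, \<open>(v, b)\<close> is present. These
  pairs contribute at most \<open>length xs - 1\<close> arcs; what remains is an arc from the last
  vertex and one to the first.\<close>

lemma deg_in_path_le:
  assumes "dpath r xs" "v \<notin> set xs" "xs \<noteq> []"
    and "\<And>as a b bs. xs = as @ a # b # bs \<Longrightarrow> \<not> ((a, v) \<in> r \<and> (v, b) \<in> r)"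
  shows "deg_in r (set xs) v \<le> length xs + (if (v, hd xs) \<in> r then 1 else 0)"
  using assms
proof (induction xs)
  case (Cons x xs)
  show ?case
  proof (cases xs)
    case Nil
    then show ?thesis using deg_in_insert[of "{}" x r v] by (simp add: deg_in_def)
  next
    case (Cons y ys)
    have "dpath r xs" using Cons.prems(1) Cons by (simp add: dpath_def)
    moreover have "\<not> ((a, v) \<in> r \<and> (v, b) \<in> r)" if "xs = as @ a # b # bs" for as a b bs
      using Cons.prems(4)[of "x # as" a b bs] that by simp
    ultimately have "deg_in r (set xs) v \<le> length xs + (if (v, y) \<in> r then 1 else 0)"
      using Cons.IH Cons.prems(2) Cons by simp
    moreover have "\<not> ((x, v) \<in> r \<and> (v, y) \<in> r)" using Cons.prems(4)[of "[]"] Cons by simp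
    moreover have "x \<notin> set xs" using Cons.prems(1) by (simp add: dpath_def)
    ultimately show ?thesis using deg_in_insert[of "set xs" x r v] by (auto split: if_splits)
  qed
qed simp

lemma dpath_insert:
  assumes "dpath r (as @ a # b # bs)" "v \<notin> set (as @ a # b # bs)" "(a, v) \<in> r" "(v, b) \<in> r"
  shows "dpath r (as @ a # v # b # bs)"
  using assms by (auto simp: dpath_def successively_append_iff)

lemma dcycle_rotate:
  assumes "dcycle r (xs @ ys)"
  shows "dcycle r (ys @ xs)"
proof (cases "xs = [] \<or> ys = []")
  case False
  then have "length (xs @ ys) \<noteq> 1" by (cases xs; cases ys) auto
  with False assms show ?thesis by (auto simp: dcycle_def dpath_def successively_append_iff)
qed (use assms in auto)

section \<open>Reachability, strong vertex sets and the removal of a vertex\<close>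

lemma exit_edge:
  assumes "(u, w) \<in> (Restr r V)\<^sup>*" "u \<in> U" "w \<notin> U"
  shows "\<exists>u'\<in>U. \<exists>w'\<in>V - U. (u, u') \<in> (Restr r U)\<^sup>* \<and> (u', w') \<in> r"
  using assms
proof (induction rule: converse_rtrancl_induct)
  case (step y z)
  show ?case
  \<comment> \<open>The arc sought is the first one leaving \<open>U\<close>: it is
    \<open>(y, z)\<close> itself unless \<open>z\<close> still lies in \<open>U\<close>.\<close>
  proof (cases "z \<in> U")
    case True
    then obtain u' w' where *: "u' \<in> U" "w' \<in> V - U" "(z, u') \<in> (Restr r U)\<^sup>*" "(u', w') \<in> r"
      using step by blast
    have "(y, z) \<in> Restr r U" using step True by auto
    then have "(y, u') \<in> (Restr r U)\<^sup>*" using *(3) by (rule converse_rtrancl_into_rtrancl)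
    then show ?thesis using * by blast
  qed (use step in blast)
qed simp

text \<open>Walks shorten to paths: if the new first vertex already occurs, only the part of the
  path starting there is kept.\<close>

lemma rtrancl_Restr_dpath:
  assumes "(u, w) \<in> (Restr r U)\<^sup>*" "u \<in> U"
  shows "\<exists>ys. dpath r ys \<and> ys \<noteq> [] \<and> set ys \<subseteq> U \<and> hd ys = u \<and> last ys = w"
  using assms
proof (induction rule: converse_rtrancl_induct)
  case base
  show ?case by (rule exI[of _ "[w]"]) (use base in \<open>auto simp: dpath_def\<close>)
next
  case (step y z)
  then obtain ys where ys: "dpath r ys" "ys \<noteq> []" "set ys \<subseteq> U" "hd ys = z" "last ys = w" by auto
  show ?case
  proof (cases "y \<in> set ys")
    case True
    then obtain as bs where "ys = as @ y # bs" by (meson split_list)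
    then show ?thesis using ys
      by (intro exI[of _ "y # bs"]) (auto simp: dpath_def successively_append_iff)
  next
    case False
    then show ?thesis using ys step
      by (intro exI[of _ "y # ys"]) (auto simp: dpath_def successively_Cons)
  qed
qed

text \<open>Adding an ear preserves strongness: a vertex of \<open>W\<close> reaches
  \<open>t'\<close>, continues inside \<open>T\<close> to \<open>t\<close>, and is reached back from
  \<open>t\<close>. So \<open>t\<close> serves as a hub for all vertices.\<close>

lemma strong_on_insert:
  assumes "strong_on r T" "t \<in> T" "t' \<in> T"
    and "\<And>x. x \<in> W \<Longrightarrow> (t, x) \<in> (Restr r (T \<union> W))\<^sup>* \<and> (x, t') \<in> (Restr r (T \<union> W))\<^sup>*"
  shows "strong_on r (T \<union> W)"
proof -
  have mono: "(Restr r T)\<^sup>* \<subseteq> (Restr r (T \<union> W))\<^sup>*" by (intro rtrancl_mono) auto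
  have "(x, t) \<in> (Restr r (T \<union> W))\<^sup>* \<and> (t, x) \<in> (Restr r (T \<union> W))\<^sup>*" if "x \<in> T \<union> W" for x
  proof (cases "x \<in> T")
    case True
    then show ?thesis using assms(1,2) mono unfolding strong_on_def by blast
  next
    case False
    then have "x \<in> W" using that by auto
    moreover have "(t', t) \<in> (Restr r (T \<union> W))\<^sup>*" using assms(1-3) mono unfolding strong_on_def by blast
    ultimately show ?thesis using assms(4) by (meson rtrancl_trans)
  qed
  then show ?thesis unfolding strong_on_def by (meson rtrancl_trans)
qed

text \<open>Take a maximal proper strong subset T. A shortest path leaving and re-entering T exhausts
  the remaining vertices, so that its first outer vertex has out-degree 1, unless it is the only one.\<close>
lemma strong_on_remove_vertex:
  assumes "finite V" "card V \<ge> 2" "strong_on r V" and irr: "\<And>v. (v, v) \<notin> r"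
    and out: "\<And>v. v \<in> V \<Longrightarrow> card {w \<in> V. (v, w) \<in> r} \<ge> 2"
  shows "\<exists>v\<in>V. strong_on r (V - {v})"
proof -
  define P where "P T \<longleftrightarrow> T \<subset> V \<and> T \<noteq> {} \<and> strong_on r T" for T
  obtain v where "v \<in> V" using assms(2) by fastforce
  have "P {v}" unfolding P_def strong_on_def using \<open>v \<in> V\<close> assms(2) by auto
  moreover have "\<forall>T. P T \<longrightarrow> card T \<le> card V"
    using assms(1) by (auto simp: P_def intro: card_mono)
  ultimately obtain T where T: "P T" "\<And>T'. P T' \<Longrightarrow> card T' \<le> card T"
    using ex_has_greatest_nat[of P "{v}" card "Suc (card V)"] by (auto simp: less_Suc_eq_le)
  define U where "U = V - T"
  have TV: "T \<subset> V" "T \<noteq> {}" "strong_on r T" using T(1) by (auto simp: P_def)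
  \<comment> \<open>\<open>T\<close> has the greatest cardinality among the nonempty proper strong
    subsets, so a larger strong set cannot be proper.\<close>
  have bigger: "T' = V" if "T \<subset> T'" "T' \<subseteq> V" "strong_on r T'" for T'
  proof (rule ccontr)
    assume "T' \<noteq> V"
    then have "P T'" using that TV by (auto simp: P_def)
    then have "card T' \<le> card T" by (rule T(2))
    moreover have "finite T'" using that(2) assms(1) by (rule finite_subset)
    ultimately show False using psubset_card_mono[of T' T] that(1) by simp
  qed
  \<comment> \<open>\<open>Q n\<close>: some walk leaves \<open>T\<close>, uses \<open>n\<close>
    arcs inside \<open>U\<close> and returns to \<open>T\<close>. The least such \<open>n\<close>
    gives an ear without shortcuts.\<close>
  define Q where "Q n \<longleftrightarrow> (\<exists>t\<in>T. \<exists>t'\<in>T. \<exists>a\<in>U. \<exists>b\<in>U. (t, a) \<in> r \<and> (a, b) \<in> Restr r U ^^ n \<and> (b, t') \<in> r)" for n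
  have "\<exists>n. Q n"
  proof -
    obtain t u where tu: "t \<in> T" "u \<in> U" using TV unfolding U_def by blast
    then have "(t, u) \<in> (Restr r V)\<^sup>*" using assms(3) TV unfolding U_def strong_on_def by blast
    then obtain t1 a where a: "t1 \<in> T" "a \<in> V - T" "(t1, a) \<in> r"
      using exit_edge[of t u r V T] tu unfolding U_def by blast
    have "(a, t) \<in> (Restr r V)\<^sup>*" using assms(3) TV a tu unfolding strong_on_def by blast
    then obtain b t' where "b \<in> U" "t' \<in> V - U" "(a, b) \<in> (Restr r U)\<^sup>*" "(b, t') \<in> r"
      using exit_edge[of a t r V U] a tu unfolding U_def by blast
    moreover from this obtain n where "(a, b) \<in> Restr r U ^^ n" by (meson rtrancl_imp_relpow)
    ultimately have "Q n" using a unfolding Q_def U_def by blast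
    then show ?thesis ..
  qed
  then obtain n where n: "Q n" "\<And>m. m < n \<Longrightarrow> \<not> Q m" by (meson exists_least_iff)
  then obtain t t' a b f where f: "t \<in> T" "t' \<in> T" "a \<in> U" "b \<in> U" "(t, a) \<in> r" "(b, t') \<in> r"
      "f 0 = a" "f n = b" "\<And>i. i < n \<Longrightarrow> (f i, f (Suc i)) \<in> Restr r U"
    unfolding Q_def relpow_fun_conv by blast
  have fU: "f i \<in> U" if "i \<le> n" for i
    using that f(3,7) f(9)[of "i - 1"] by (cases i) auto
  have path: "(f i, f j) \<in> Restr r U ^^ (j - i)" if "i \<le> j" "j \<le> n" for i j
    unfolding relpow_fun_conv using that f(9) by (intro exI[of _ "\<lambda>l. f (i + l)"]) auto
  define W where "W = f ` {..n}"
  have fW: "(f i, f j) \<in> (Restr r (T \<union> W))\<^sup>*" if "i \<le> j" "j \<le> n" for i j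
    using that
  proof (induction j)
    case (Suc j)
    show ?case
    proof (cases "i = Suc j")
      case False
      moreover have "(f j, f (Suc j)) \<in> Restr r (T \<union> W)"
        using f(9)[of j] Suc.prems by (auto simp: W_def)
      ultimately show ?thesis using Suc by (meson Suc_leD le_Suc_eq rtrancl.rtrancl_into_rtrancl)
    qed simp
  qed simp
  have "strong_on r (T \<union> W)"
  proof (rule strong_on_insert[OF TV(3) f(1,2)])
    fix x assume "x \<in> W"
    then obtain i where i: "x = f i" "i \<le> n" by (auto simp: W_def)
    have "(t, f 0) \<in> Restr r (T \<union> W)" "(f n, t') \<in> Restr r (T \<union> W)"
      using f by (auto simp: W_def)
    then show "(t, x) \<in> (Restr r (T \<union> W))\<^sup>* \<and> (x, t') \<in> (Restr r (T \<union> W))\<^sup>*"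
      using fW[of 0 i] fW[of i n] i
      by (meson converse_rtrancl_into_rtrancl le0 order_refl rtrancl.rtrancl_into_rtrancl)
  qed
  moreover have "a \<in> W" using f(7) by (auto simp: W_def)
  then have "T \<subset> T \<union> W" using f(3) by (auto simp: U_def)
  moreover have "T \<union> W \<subseteq> V" using TV(1) fU by (auto simp: W_def U_def)
  \<comment> \<open>With its ear, \<open>T\<close> is a strictly larger strong set, so the ear uses
    up every vertex of \<open>U\<close>.\<close>
  ultimately have V: "T \<union> W = V" by (intro bigger)
  show ?thesis
  proof (cases "n = 0")
    case True
    then have "V - {a} = T" using V f(3,7) by (auto simp: W_def U_def)
    then show ?thesis using TV(3) f(3) by (auto simp: U_def)
  next
    case False
    \<comment> \<open>An arc from \<open>a\<close> back to \<open>T\<close> would give an ear with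
      \<open>n = 0\<close>, and an arc to \<open>f j\<close> with \<open>j > 1\<close> would shorten
      the ear to \<open>Suc (n - j) < n\<close> inner arcs.\<close>
    have "w = f 1" if w: "w \<in> V" "(a, w) \<in> r" for w
    proof (cases "w \<in> T")
      case True
      have "Q 0" unfolding Q_def using f w True by auto
      then show ?thesis using n False by blast
    next
      case False
      then obtain j where j: "w = f j" "j \<le> n" using V w(1) by (auto simp: W_def)
      have "j \<noteq> 0" using irr w(2) j f(7) by (metis)
      moreover have "\<not> 1 < j"
      proof
        assume "1 < j"
        have "(a, f j) \<in> Restr r U" using w j fU f(3) by auto
        then have "(a, b) \<in> Restr r U ^^ Suc (n - j)"
          using path[OF j(2) order_refl] unfolding f(8) by (rule relpow_Suc_I2)
        then have "Q (Suc (n - j))" unfolding Q_def using f by blast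
        then show False using n(2)[of "Suc (n - j)"] \<open>1 < j\<close> j by simp
      qed
      ultimately have "j = 1" by linarith
      then show ?thesis using j by simp
    qed
    then have "{w \<in> V. (a, w) \<in> r} \<subseteq> {f 1}" by auto
    then have "card {w \<in> V. (a, w) \<in> r} \<le> 1" using card_mono[of "{f 1}"] by fastforce
    then show ?thesis using out[of a] f(3) by (auto simp: U_def)
  qed
qed

section \<open>Hamilton cycles and pancyclicity\<close>

text \<open>The argument of Bondy and Thomassen: take a longest cycle and an ear of it with the fewest
  skipped vertices (gap), and reroute a path through as many skipped vertices as possible.\<close>
theorem ghouila_houri:
  assumes "finite V" "V \<noteq> {}" "strong_on r V" and irr: "\<And>v. (v, v) \<notin> r"
    and deg: "\<And>v. v \<in> V \<Longrightarrow> deg_in r V v \<ge> card V"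
  shows "\<exists>xs. dcycle r xs \<and> set xs = V"
proof -
  obtain v0 where "v0 \<in> V" using assms(2) by auto
  define P where "P xs \<longleftrightarrow> dcycle r xs \<and> set xs \<subseteq> V" for xs
  have "P [v0]" using \<open>v0 \<in> V\<close> by (simp add: P_def dcycle_def dpath_def)
  moreover have dist: "distinct xs" if "P xs" for xs using that by (simp add: P_def dcycle_def dpath_def)
  have "length xs < Suc (card V)" if "P xs" for xs
    using card_mono[of V "set xs"] distinct_card[OF dist[OF that]] assms(1) that by (simp add: P_def)
  ultimately obtain cs where cs: "P cs" "\<And>xs. P xs \<Longrightarrow> length xs \<le> length cs"
    using ex_has_greatest_nat[of P "[v0]" length "Suc (card V)"] by auto
  define C where "C = set cs"
  define U where "U = V - C"
  have CV: "C \<subseteq> V" "C \<noteq> {}" "finite C" using cs(1) by (auto simp: P_def C_def dcycle_def)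
  have maxC: "card (set xs) \<le> card C" if "P xs" for xs
    using cs(2)[OF that] distinct_card[OF dist[OF that]] distinct_card[OF dist[OF cs(1)]] by (simp add: C_def)
  have "C = V"
  proof (rule ccontr)
    assume "C \<noteq> V"
    \<comment> \<open>The entry point \<open>y\<close> is kept as a parameter, since its degree
      enters the final count.\<close>
    define ear where "ear c y d \<longleftrightarrow> y \<in> U \<and> (c, y) \<in> r \<and>
      (\<exists>y'\<in>U. (y, y') \<in> (Restr r U)\<^sup>* \<and> (y', d) \<in> r)" for c y d
    \<comment> \<open>\<open>gap\<close> lists the cycle vertices skipped by the ear, which ends at
      the first vertex after them. For empty \<open>rest\<close> this is \<open>c\<close> itself,
      which covers an ear returning to its start.\<close>
    define conf where "conf = (\<lambda>(c, gap, rest, y).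
      dcycle r (c # gap @ rest) \<and> set (c # gap @ rest) = C \<and> ear c y (hd (rest @ [c])))"
    have "\<exists>z. conf z"
    proof -
      obtain c0 u where u: "c0 \<in> C" "u \<in> U" using CV \<open>C \<noteq> V\<close> by (auto simp: U_def)
      have reach: "(x, x') \<in> (Restr r V)\<^sup>*" if "x \<in> V" "x' \<in> V" for x x'
        using assms(3) that by (auto simp: strong_on_def)
      obtain c y where y: "c \<in> C" "y \<in> U" "(c, y) \<in> r"
        using exit_edge[OF reach, of c0 u C] u CV by (auto simp: U_def)
      obtain y' d where d: "y' \<in> U" "d \<in> C" "(y, y') \<in> (Restr r U)\<^sup>*" "(y', d) \<in> r"
        using exit_edge[OF reach, of y c0 U] u y CV by (auto simp: U_def)
      obtain as bs where "cs = as @ c # bs" using y(1) by (metis C_def split_list)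
      then have cyc: "dcycle r (c # bs @ as)" "set (c # bs @ as) = C"
        using cs(1) dcycle_rotate[of r as "c # bs"] by (auto simp: P_def C_def)
      have "ear c y d" using y d by (auto simp: ear_def)
      show ?thesis
      proof (cases "d = c")
        case True
        then have "conf (c, bs @ as, [], y)" using cyc \<open>ear c y d\<close> by (simp add: conf_def)
        then show ?thesis ..
      next
        case False
        then have "d \<in> set (bs @ as)" using d(2) cyc(2) by auto
        then obtain gap rest where "bs @ as = gap @ d # rest" by (meson split_list)
        then have "conf (c, gap, d # rest, y)" using cyc \<open>ear c y d\<close> by (auto simp: conf_def)
        then show ?thesis ..
      qed
    qed
    then obtain z where "conf z" and minz: "\<And>z'. conf z' \<Longrightarrow> length (fst (snd z)) \<le> length (fst (snd z'))"
      using ex_has_least_nat[of conf _ "\<lambda>z. length (fst (snd z))"] by blast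
    obtain c gap rest y where z: "z = (c, gap, rest, y)" by (cases z)
    define Q where "Q = rest @ [c]"
    define d where "d = hd Q"
    have cyc: "dcycle r (c # gap @ rest)" and setC: "set (c # gap @ rest) = C" and ear: "ear c y d"
      using \<open>conf z\<close> by (auto simp: conf_def z Q_def d_def)
    have mingap: "length gap \<le> length gap'" if "conf (c', gap', rest', y')" for c' gap' rest' y'
      using minz[OF that] z by simp
    obtain y' where y: "y \<in> U" "(c, y) \<in> r" "y' \<in> U" "(y, y') \<in> (Restr r U)\<^sup>*" "(y', d) \<in> r"
      using ear by (auto simp: ear_def)
    \<comment> \<open>An ear from \<open>c\<close> into the gap would skip fewer vertices; so would,
      in the next claim, an ear from the gap to \<open>d\<close>.\<close>
    have no_ear1: "\<not> ear c u x" if "x \<in> set gap" for x u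
    proof
      assume e: "ear c u x"
      obtain g1 g2 where g: "gap = g1 @ x # g2" using \<open>x \<in> set gap\<close> by (meson split_list)
      have "conf (c, g1, x # g2 @ rest, u)" using cyc setC e by (auto simp: conf_def g)
      from mingap[OF this] show False by (simp add: g)
    qed
    have no_ear2: "\<not> ear x u d" if "x \<in> set gap" for x u
    proof
      assume e: "ear x u d"
      obtain g1 g2 where g: "gap = g1 @ x # g2" using \<open>x \<in> set gap\<close> by (meson split_list)
      have "dcycle r (x # g2 @ rest @ c # g1)" using dcycle_rotate[of r "c # g1" "x # g2 @ rest"] cyc by (simp add: g)
      moreover have "hd (rest @ c # g1 @ [x]) = d" by (cases rest) (auto simp: d_def Q_def)
      ultimately have "conf (x, g2, rest @ c # g1, u)" using setC e by (auto simp: conf_def g)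
      from mingap[OF this] show False by (simp add: g)
    qed
    have cycQ: "dcycle r (Q @ gap)" using dcycle_rotate[of r "c # gap" rest] cyc by (simp add: Q_def)
    have setQ: "set Q \<union> set gap = C" "set Q \<inter> set gap = {}" "distinct Q"
      using setC cyc by (auto simp: Q_def dcycle_def dpath_def)
    \<comment> \<open>A second extremal choice: \<open>Q'\<close> is a longest path from
      \<open>d\<close> to \<open>c\<close> within \<open>C\<close> through all of \<open>Q\<close>,
      so it absorbs as many gap vertices as possible.\<close>
    define D where "D xs \<longleftrightarrow> dpath r xs \<and> set Q \<subseteq> set xs \<and> set xs \<subseteq> C \<and> hd xs = d \<and> last xs = c" for xs
    have Qne: "Q \<noteq> []" by (simp add: Q_def)
    have "D Q" using cyc setQ cycQ by (auto simp: D_def d_def Q_def dcycle_def dpath_def successively_append_iff)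
    moreover have "length xs < Suc (card C)" if "D xs" for xs
      using card_mono[of C "set xs"] distinct_card[of xs] CV that by (auto simp: D_def dpath_def)
    ultimately obtain Q' where Q': "D Q'" "\<And>xs. D xs \<Longrightarrow> length xs \<le> length Q'"
      using ex_has_greatest_nat[of D Q length "Suc (card C)"] by auto
    have Q'ne: "Q' \<noteq> []" using Q'(1) Qne by (auto simp: D_def)
    \<comment> \<open>Otherwise \<open>Q'\<close>, closed up by a path through the ear, would be a
      cycle longer than \<open>cs\<close>.\<close>
    have "set Q' \<noteq> C"
    proof
      assume eq: "set Q' = C"
      obtain ys where ys: "dpath r ys" "ys \<noteq> []" "set ys \<subseteq> U" "hd ys = y" "last ys = y'"
        using rtrancl_Restr_dpath[OF y(4,1)] by blast
      have "P (ys @ Q')" using ys Q'(1) Q'ne y eq CV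
        by (auto simp: P_def dcycle_def dpath_def successively_append_iff D_def U_def)
      then have "card (set (ys @ Q')) \<le> card C" by (rule maxC)
      moreover have "C \<subset> set (ys @ Q')"
        using ys eq by (cases ys) (auto simp: U_def)
      then have "card C < card (set (ys @ Q'))" by (intro psubset_card_mono) auto
      ultimately show False by simp
    qed
    then obtain x where x: "x \<in> C" "x \<notin> set Q'" using Q'(1) by (auto simp: D_def)
    have xgap: "x \<in> set gap" using x setQ(1) Q'(1) by (auto simp: D_def)
    \<comment> \<open>Inserting \<open>x\<close> into \<open>Q'\<close> would contradict the length
      of \<open>Q'\<close>.\<close>
    have "\<not> ((a, x) \<in> r \<and> (x, b) \<in> r)" if s: "Q' = as @ a # b # bs" for as a b bs
    proof
      assume "(a, x) \<in> r \<and> (x, b) \<in> r"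
      then have "dpath r (as @ a # x # b # bs)"
        using dpath_insert[of r as a b bs x] Q'(1) x(2) by (simp add: D_def s)
      then have "D (as @ a # x # b # bs)"
        using Q'(1) x(1) by (cases as) (auto simp: D_def s)
      from Q'(2)[OF this] show False by (simp add: s)
    qed
    then have "deg_in r (set Q') x \<le> length Q' + (if (x, hd Q') \<in> r then 1 else 0)"
      using Q'(1) x Q'ne by (intro deg_in_path_le) (auto simp: D_def)
    then have 1: "deg_in r (set Q') x \<le> length Q' + 1" by (auto split: if_splits)
    \<comment> \<open>Inserting \<open>y\<close> into \<open>Q\<close> and closing up through
      \<open>gap\<close> would give a cycle on \<open>insert y C\<close>.\<close>
    have "\<not> ((a, y) \<in> r \<and> (y, b) \<in> r)" if s: "Q = as @ a # b # bs" for as a b bs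
    proof
      assume *: "(a, y) \<in> r \<and> (y, b) \<in> r"
      have yC: "y \<notin> C" using y(1) by (simp add: U_def)
      have "dpath r (as @ a # y # b # bs @ gap)"
        using dpath_insert[of r as a b "bs @ gap" y] cycQ * yC setQ by (auto simp: s dcycle_def)
      moreover have "set Q \<subseteq> V" "set gap \<subseteq> V" "y \<in> V" using setQ CV y by (auto simp: U_def)
      ultimately have "P ((as @ a # y # b # bs) @ gap)"
        using cycQ by (cases as) (auto simp: P_def dcycle_def s)
      moreover have "set ((as @ a # y # b # bs) @ gap) = insert y C"
        using setQ(1) unfolding s by auto
      ultimately have "card (insert y C) \<le> card C" using maxC by metis
      then show False using yC CV by simp
    qed
    then have "deg_in r (set Q) y \<le> length Q + (if (y, hd Q) \<in> r then 1 else 0)"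
      using \<open>D Q\<close> y setQ Qne by (intro deg_in_path_le) (auto simp: D_def U_def)
    then have 2: "deg_in r (set Q) y \<le> length Q + 1" by (auto split: if_splits)
    \<comment> \<open>An arc between \<open>y\<close> and a gap vertex, in either direction, would
      complete one of the two forbidden ears.\<close>
    have xy: "(x, y) \<notin> r" "(y, x) \<notin> r"
      using no_ear1[OF xgap, of y] no_ear2[OF xgap, of y] y by (auto simp: ear_def)
    have 3: "deg_in r (set gap) y = 0"
    proof -
      have "(w, y) \<notin> r" "(y, w) \<notin> r" if "w \<in> set gap" for w
        using no_ear1[OF that, of y] no_ear2[OF that, of y] y by (auto simp: ear_def)
      then have "{w \<in> set gap. (y, w) \<in> r} = {}" "{w \<in> set gap. (w, y) \<in> r} = {}" by auto
      then show ?thesis by (simp add: deg_in_def)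
    qed
    have 4: "deg_in r (C - set Q') x \<le> 2 * (card C - card (set Q') - 1)"
    proof -
      have "deg_in r (C - set Q') x = deg_in r (C - set Q' - {x}) x" using irr by (simp add: deg_in_remove)
      also have "\<dots> \<le> 2 * card (C - set Q' - {x})" using CV by (intro deg_in_le_double_card) auto
      also have "card (C - set Q' - {x}) = card C - card (set Q') - 1"
        using x Q'(1) CV by (simp add: card_Diff_subset D_def)
      finally show ?thesis .
    qed
    \<comment> \<open>A vertex \<open>w\<close> of \<open>U\<close> on a walk \<open>x\<close>,
      \<open>w\<close>, \<open>y\<close> would begin an ear from \<open>x\<close> to
      \<open>d\<close>, and on a walk \<open>y\<close>, \<open>w\<close>, \<open>x\<close> it would
      complete an ear from \<open>c\<close> to \<open>x\<close>. The neighbourhoods are thus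
      disjoint in pairs, and all four avoid \<open>y\<close> by \<open>xy\<close> and
      \<open>irr\<close>.\<close>
    have 5: "deg_in r U x + deg_in r U y \<le> 2 * (card U - 1)"
    proof -
      have finU: "finite U" using assms(1) by (simp add: U_def)
      have disj: "{w \<in> U. (x, w) \<in> r} \<inter> {w \<in> U. (w, y) \<in> r} = {}"
        "{w \<in> U. (y, w) \<in> r} \<inter> {w \<in> U. (w, x) \<in> r} = {}"
      proof -
        have False if "w \<in> U" "(x, w) \<in> r" "(w, y) \<in> r" for w
        proof -
          have "(w, y') \<in> (Restr r U)\<^sup>*" using that y by (meson IntI SigmaI converse_rtrancl_into_rtrancl)
          then show False using no_ear2[OF xgap, of w] that y by (auto simp: ear_def)
        qed
        then show "{w \<in> U. (x, w) \<in> r} \<inter> {w \<in> U. (w, y) \<in> r} = {}" by auto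
        have False if "w \<in> U" "(y, w) \<in> r" "(w, x) \<in> r" for w
        proof -
          have "(y, w) \<in> (Restr r U)\<^sup>*" using that y by auto
          then show False using no_ear1[OF xgap, of y] that y by (auto simp: ear_def)
        qed
        then show "{w \<in> U. (y, w) \<in> r} \<inter> {w \<in> U. (w, x) \<in> r} = {}" by auto
      qed
      have "card {w \<in> U. (x, w) \<in> r} + card {w \<in> U. (w, y) \<in> r} = card ({w \<in> U. (x, w) \<in> r} \<union> {w \<in> U. (w, y) \<in> r})"
        using finU disj by (simp add: card_Un_disjoint)
      also have "\<dots> \<le> card (U - {y})" using finU irr xy by (intro card_mono) auto
      finally have a: "card {w \<in> U. (x, w) \<in> r} + card {w \<in> U. (w, y) \<in> r} \<le> card U - 1" using y by simp
      have "card {w \<in> U. (y, w) \<in> r} + card {w \<in> U. (w, x) \<in> r} = card ({w \<in> U. (y, w) \<in> r} \<union> {w \<in> U. (w, x) \<in> r})"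
        using finU disj by (simp add: card_Un_disjoint)
      also have "\<dots> \<le> card (U - {y})" using finU irr xy by (intro card_mono) auto
      finally have "card {w \<in> U. (y, w) \<in> r} + card {w \<in> U. (w, x) \<in> r} \<le> card U - 1" using y by simp
      with a show ?thesis by (simp add: deg_in_def)
    qed
    have VU: "V = U \<union> C" "U \<inter> C = {}" "finite U" "card V = card U + card C"
      using CV assms(1) card_Un_disjoint[of U C] by (auto simp: U_def Un_absorb2)
    have "deg_in r V x = deg_in r U x + (deg_in r (set Q') x + deg_in r (C - set Q') x)"
      using deg_in_Un[of U C r x] deg_in_Un[of "set Q'" "C - set Q'" r x] VU CV Q'(1)
      by (simp add: D_def Un_absorb1)
    moreover have "deg_in r V y = deg_in r U y + (deg_in r (set Q) y + deg_in r (set gap) y)"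
      using deg_in_Un[of U C r y] deg_in_Un[of "set Q" "set gap" r y] VU CV setQ by simp
    moreover have "length Q \<le> length Q'" using Q'(2) \<open>D Q\<close> by blast
    moreover have "card (set Q') = length Q'" using Q'(1) by (simp add: D_def dpath_def distinct_card)
    moreover have "card (set Q') < card C"
      using x Q'(1) CV by (intro psubset_card_mono) (auto simp: D_def)
    moreover have "card U \<ge> 1" using y VU by (metis One_nat_def Suc_leI card_gt_0_iff empty_iff)
    moreover have "deg_in r V x \<ge> card V" "deg_in r V y \<ge> card V"
      using deg x(1) y(1) CV by (auto simp: U_def)
    \<comment> \<open>The bounds add up to at most 2|V| + |Q| - |Q'| - 2, hence to less than 2|V|,
      whereas the hypothesis gives at least 2|V|.\<close>
    ultimately show False using 1 2 3 4 5 VU(4) by linarith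
  qed
  then show ?thesis using cs(1) by (auto simp: C_def P_def)
qed

text \<open>Pigeonhole: shift the positions of the out-neighbours of \<open>v\<close> by
  \<open>l - 2\<close> along the cycle. More than \<open>length xs\<close> arcs at \<open>v\<close>
  force a shifted position to be that of an in-neighbour, and the segment of \<open>l - 1\<close>
  vertices in between closes up through \<open>v\<close>.\<close>

lemma dcycle_through_vertex:
  assumes "dcycle r xs" "v \<notin> set xs" "deg_in r (set xs) v \<ge> length xs + 1"
    and "2 \<le> l" "l \<le> length xs + 1"
  shows "\<exists>ys. dcycle r ys \<and> length ys = l \<and> set ys \<subseteq> insert v (set xs)"
proof -
  define m where "m = length xs"
  define t where "t = l - 2"
  have m: "m > 0" "t < m" using assms by (auto simp: m_def t_def dcycle_def)
  have dist: "distinct xs" using assms(1) by (simp add: dcycle_def dpath_def)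
  have card_index: "card {w \<in> set xs. P w} = card {i \<in> {..<m}. P (xs ! i)}" for P
  proof -
    have "{w \<in> set xs. P w} = (!) xs ` {i \<in> {..<m}. P (xs ! i)}"
      by (auto simp: m_def in_set_conv_nth)
    moreover have "inj_on ((!) xs) {i \<in> {..<m}. P (xs ! i)}"
      using dist by (auto simp: inj_on_def m_def nth_eq_iff_index_eq)
    ultimately show ?thesis by (simp add: card_image)
  qed
  define A where "A = {i \<in> {..<m}. (v, xs ! i) \<in> r}"
  define B where "B = {i \<in> {..<m}. (xs ! i, v) \<in> r}"
  have AB: "card A + card B \<ge> m + 1"
    using assms(3) unfolding deg_in_def card_index A_def B_def m_def .
  define s where "s = (\<lambda>i. (i + t) mod m)"
  have "inj_on s {..<m}"
  proof (rule inj_onI)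
    fix i j assume ij: "i \<in> {..<m}" "j \<in> {..<m}" "s i = s j"
    then show "i = j" using m(2) by (auto simp: s_def mod_if split: if_splits)
  qed
  then have "card (s ` A) = card A" by (intro card_image) (auto simp: A_def inj_on_def)
  moreover have "s ` A \<union> B \<subseteq> {..<m}" using m by (auto simp: s_def B_def)
  then have "card (s ` A \<union> B) \<le> m" using card_mono[of "{..<m}"] by fastforce
  ultimately have "s ` A \<inter> B \<noteq> {}"
    using AB card_Un_disjoint[of "s ` A" B] by (auto simp: A_def B_def)
  then obtain i where i: "i < m" "(v, xs ! i) \<in> r" "(xs ! ((i + t) mod m), v) \<in> r"
    by (auto simp: A_def B_def s_def)
  define zs where "zs = take (Suc t) (rotate i xs)"
  have rot: "dcycle r (rotate i xs)"
    using assms(1) dcycle_rotate[of r "take (i mod m) xs" "drop (i mod m) xs"]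
    by (simp add: rotate_drop_take m_def)
  have len: "length zs = Suc t" using m by (simp add: zs_def m_def)
  then have "zs \<noteq> []" by auto
  have "dpath r (zs @ drop (Suc t) (rotate i xs))" using rot by (simp add: zs_def dcycle_def)
  then have "dpath r zs" by (auto simp: dpath_def successively_append_iff)
  moreover have "hd zs = xs ! i"
    using hd_rotate_conv_nth[of xs i] i m by (simp add: zs_def m_def hd_take)
  moreover have "last zs = xs ! ((i + t) mod m)"
    using last_conv_nth[OF \<open>zs \<noteq> []\<close>] len m by (simp add: zs_def m_def nth_rotate)
  moreover have sub: "set zs \<subseteq> set xs" unfolding zs_def by (metis set_rotate set_take_subset)
  ultimately have "dcycle r (v # zs)"
    using i \<open>zs \<noteq> []\<close> assms(2) by (auto simp: dcycle_def dpath_def successively_Cons)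
  then show ?thesis using len sub assms(4) by (intro exI[of _ "v # zs"]) (auto simp: t_def)
qed

theorem pancyclic:
  assumes "finite V" "strong_on r V" and irr: "\<And>v. (v, v) \<notin> r"
    and deg: "\<And>v. v \<in> V \<Longrightarrow> deg_in r V v \<ge> card V + 1"
    and "2 \<le> l" "l \<le> card V"
  shows "\<exists>xs. dcycle r xs \<and> length xs = l \<and> set xs \<subseteq> V"
proof -
  \<comment> \<open>At most \<open>card V - 1\<close> of the \<open>card V + 1\<close> arcs at
    \<open>v\<close> are incoming.\<close>
  have "card {w \<in> V. (v, w) \<in> r} \<ge> 2" if "v \<in> V" for v
  proof -
    have "card {w \<in> V. (w, v) \<in> r} \<le> card (V - {v})"
      using assms(1) irr by (intro card_mono) auto
    then show ?thesis using deg[OF that] that assms(5,6) by (simp add: deg_in_def)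
  qed
  then obtain v where v: "v \<in> V" "strong_on r (V - {v})"
    using strong_on_remove_vertex[of V r] assms by fastforce
  have cV: "card (V - {v}) = card V - 1" using v(1) by simp
  have ins: "insert v (V - {v}) = V" using v(1) by auto
  have "\<exists>xs. dcycle r xs \<and> set xs = V - {v}"
  proof (rule ghouila_houri)
    show "V - {v} \<noteq> {}" using cV assms(5,6) by (intro notI) simp
    fix w assume "w \<in> V - {v}"
    then have "card V + 1 \<le> deg_in r (insert v (V - {v})) w" using deg ins by simp
    \<comment> \<open>Deleting \<open>v\<close> costs at most two arcs, which leaves
      \<open>card V - 1\<close>, the degree required for a Hamilton cycle of
      \<open>V - {v}\<close>.\<close>
    also have "\<dots> \<le> deg_in r (V - {v}) w + 2" using assms(1) by (subst deg_in_insert) auto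
    finally show "card (V - {v}) \<le> deg_in r (V - {v}) w" using cV by simp
  qed (use assms v irr in auto)
  then obtain xs where xs: "dcycle r xs" "set xs = V - {v}" by blast
  moreover have "length xs = card V - 1"
    using xs cV distinct_card[of xs] by (simp add: dcycle_def dpath_def)
  moreover have "deg_in r (V - {v}) v \<ge> card V + 1"
    using deg[OF v(1)] irr by (simp add: deg_in_remove)
  ultimately show ?thesis
    using dcycle_through_vertex[of r xs v l] assms(5,6) ins by auto
qed

section \<open>Strong components\<close>

text \<open>The equivalence classes are the strong components.\<close>

definition mutual :: "('a \<times> 'a) set \<Rightarrow> 'a set \<Rightarrow> ('a \<times> 'a) set" where
  "mutual r V = {(u, w). u \<in> V \<and> w \<in> V \<and> (u, w) \<in> (Restr r V)\<^sup>* \<and> (w, u) \<in> (Restr r V)\<^sup>*}"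

lemma equiv_mutual: "equiv V (mutual r V)"
  by (rule equivI) (auto simp: mutual_def refl_on_def sym_def trans_def intro: rtrancl_trans)

text \<open>A walk from \<open>u\<close> to \<open>w\<close> never leaves the class: each vertex on
  it is reached from \<open>u\<close> and returns to \<open>u\<close> by way of
  \<open>w\<close>.\<close>

lemma strong_on_component:
  assumes "K \<in> V // mutual r V"
  shows "strong_on r K"
  unfolding strong_on_def
proof (intro ballI)
  fix u w assume "u \<in> K" "w \<in> K"
  then have K: "K = mutual r V `` {u}" and uw: "(u, w) \<in> mutual r V"
    using assms equiv_mutual[of V r]
    by (metis Image_singleton_iff equiv_class_eq_iff quotientE, metis quotient_eq_iff)
  have "(u, w) \<in> (Restr r V)\<^sup>*" "(w, u) \<in> (Restr r V)\<^sup>*" using uw by (auto simp: mutual_def)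
  then show "(u, w) \<in> (Restr r K)\<^sup>*"
  proof (induction rule: rtrancl_induct)
    case (step y z)
    have "(y, u) \<in> (Restr r V)\<^sup>*" using step by (meson converse_rtrancl_into_rtrancl)
    moreover have "u \<in> V" using uw by (simp add: mutual_def)
    moreover have "(u, z) \<in> (Restr r V)\<^sup>*" using step by (meson rtrancl.rtrancl_into_rtrancl)
    ultimately have "y \<in> K" "z \<in> K" using step by (auto simp: K mutual_def)
    then show ?case using step \<open>(y, u) \<in> _\<close> by (meson IntI SigmaI rtrancl.rtrancl_into_rtrancl IntD1)
  qed simp
qed

text \<open>A vertex joined to \<open>v\<close> in both directions lies in the component of
  \<open>v\<close>, so each vertex outside \<open>K\<close> contributes at most one arc.\<close>

lemma deg_in_component:
  assumes "finite V" "K \<in> V // mutual r V" "v \<in> K"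
  shows "deg_in r V v \<le> deg_in r K v + (card V - card K)"
proof -
  have KV: "K \<subseteq> V" using assms(2) equiv_mutual by (metis Union_quotient Union_upper)
  have no_both: "(v, w) \<notin> r \<or> (w, v) \<notin> r" if "w \<in> V - K" for w
  proof (rule ccontr)
    assume "\<not> ?thesis"
    then have "(v, w) \<in> mutual r V" using that assms(3) KV by (auto simp: mutual_def)
    then have "w \<in> K" using assms(2,3) equiv_mutual by (metis in_quotient_imp_closed)
    then show False using that by simp
  qed
  have "{w \<in> V - K. (v, w) \<in> r} \<inter> {w \<in> V - K. (w, v) \<in> r} = {}" using no_both by auto
  then have "deg_in r (V - K) v = card ({w \<in> V - K. (v, w) \<in> r} \<union> {w \<in> V - K. (w, v) \<in> r})"
    using assms(1) by (simp add: deg_in_def card_Un_disjoint)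
  also have "\<dots> \<le> card (V - K)" using assms(1) by (intro card_mono) auto
  also have "\<dots> = card V - card K" using KV assms(1) by (simp add: card_Diff_subset finite_subset)
  finally show ?thesis
    using deg_in_Un[of K "V - K" r v] KV assms(1) by (simp add: Un_absorb1 finite_subset)
qed

text \<open>Classes larger than |V|/(k+1) number at most \<open>k\<close>, so by averaging one has
  at least |V|/k elements. All inequalities are multiplied out to stay in the naturals.\<close>

lemma large_class:
  assumes "finite V" "V \<noteq> {}" "equiv V e"
    and "\<And>K. K \<in> V // e \<Longrightarrow> card V < (k + 1) * card K"
  shows "\<exists>K\<in>V // e. card V \<le> k * card K"
proof (rule ccontr)
  assume "\<not> ?thesis"
  then have small: "k * card K < card V" if "K \<in> V // e" for K using that by auto
  have fin: "finite (V // e)" using assms(1) by (metis assms(3) equiv_type finite_quotient)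
  have "V // e \<noteq> {}" using assms(2) by (simp add: quotient_is_empty)
  have sum: "(\<Sum>K\<in>V // e. card K) = card V"
  proof -
    have "pairwise disjnt (V // e)" using assms(3) quotient_disj by (fastforce simp: pairwise_def disjnt_def)
    moreover have "finite K" if "K \<in> V // e" for K
      using that assms(1,3) by (metis Union_quotient Union_upper finite_subset)
    ultimately have "card (\<Union> (V // e)) = (\<Sum>K\<in>V // e. card K)" by (intro card_Union_disjoint) auto
    then show ?thesis using assms(3) by (simp add: Union_quotient)
  qed
  have "card (V // e) * card V = (\<Sum>K\<in>V // e. card V)" by simp
  also have "\<dots> < (\<Sum>K\<in>V // e. (k + 1) * card K)"
    using fin \<open>V // e \<noteq> {}\<close> assms(4) by (intro sum_strict_mono) auto
  also have "\<dots> = (k + 1) * card V" by (simp only: sum_distrib_left[symmetric] sum)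
  finally have "card (V // e) < k + 1" by (simp only: mult_less_cancel2)
  then have "card (V // e) \<le> k" by simp
  have "k * card V = (\<Sum>K\<in>V // e. k * card K)" by (simp only: sum_distrib_left[symmetric] sum)
  also have "\<dots> < (\<Sum>K\<in>V // e. card V)"
    using fin \<open>V // e \<noteq> {}\<close> small by (intro sum_strict_mono) auto
  also have "\<dots> = card (V // e) * card V" by simp
  finally show False using \<open>card (V // e) \<le> k\<close> by simp
qed

text \<open>The degree bound is (1 + 1/(k+1))|V| cleared of its denominator. For positive
  \<open>k\<close> the last hypothesis says that \<open>l\<close> is at most the ceiling of
  |V|/k.\<close>

lemma dcycle_of_large_degree:
  assumes "finite V" "V \<noteq> {}" and irr: "\<And>v. (v, v) \<notin> r"
    and deg: "\<And>v. v \<in> V \<Longrightarrow> (k + 1) * deg_in r V v \<ge> (k + 2) * card V"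
    and "2 \<le> l" "\<And>m. card V \<le> k * m \<Longrightarrow> l \<le> m"
  shows "\<exists>xs. dcycle r xs \<and> length xs = l \<and> set xs \<subseteq> V"
proof -
  let ?e = "mutual r V"
  have deg': "deg_in r V v > card V" if "v \<in> V" for v
  proof -
    have "(k + 1) * card V < (k + 2) * card V" using assms(1,2) by (simp add: card_gt_0_iff)
    also have "\<dots> \<le> (k + 1) * deg_in r V v" using deg[OF that] .
    finally show ?thesis by (simp only: mult_less_cancel1)
  qed
  have sub: "K \<subseteq> V" "K \<noteq> {}" if "K \<in> V // ?e" for K
    using that equiv_mutual[of V r] by (metis Union_quotient Union_upper, metis in_quotient_imp_non_empty)
  have "card V < (k + 1) * card K" if K: "K \<in> V // ?e" for K
  proof -
    obtain v where v: "v \<in> K" using sub[OF K] by auto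
    have fK: "finite K" using sub(1)[OF K] assms(1) by (rule finite_subset)
    have "deg_in r K v = deg_in r (K - {v}) v" using irr by (simp add: deg_in_remove)
    also have "\<dots> \<le> 2 * card (K - {v})" using fK by (intro deg_in_le_double_card) auto
    finally have "deg_in r K v \<le> 2 * (card K - 1)" using v by simp
    then have *: "deg_in r V v \<le> 2 * (card K - 1) + (card V - card K)"
      using deg_in_component[OF assms(1) K v] by simp
    have cK: "card K \<ge> 1" "card K \<le> card V"
      using v fK sub(1)[OF K] assms(1) by (auto simp: Suc_le_eq card_gt_0_iff card_mono)
    then have "card V \<ge> 2" using * deg'[of v] sub(1)[OF K] v by auto
    \<comment> \<open>Multiplied by \<open>k + 1\<close> and compared with the degree hypothesis,
      this forces \<open>K\<close> to be large. Writing \<open>card V = n + 2\<close> below removes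
      the truncated subtraction.\<close>
    then have "deg_in r V v \<le> (card V - 2) + card K" using * cK by linarith
    then have "(k + 1) * deg_in r V v \<le> (k + 1) * ((card V - 2) + card K)" by (intro mult_left_mono) auto
    moreover have "(k + 2) * card V \<le> (k + 1) * deg_in r V v" using deg sub(1)[OF K] v by auto
    ultimately have "(k + 2) * card V \<le> (k + 1) * ((card V - 2) + card K)" by (rule order_trans[rotated])
    moreover obtain n where n: "card V = n + 2" using \<open>card V \<ge> 2\<close> by (metis add.commute le_Suc_ex)
    ultimately show ?thesis by (simp add: algebra_simps)
  qed
  then obtain K where K: "K \<in> V // ?e" "card V \<le> k * card K"
    using large_class[OF assms(1,2) equiv_mutual] by blast
  have fK: "finite K" "card K \<le> card V" using sub(1)[OF K(1)] assms(1) by (auto intro: finite_subset card_mono)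
  have "\<exists>xs. dcycle r xs \<and> length xs = l \<and> set xs \<subseteq> K"
  proof (rule pancyclic[OF fK(1) strong_on_component[OF K(1)] irr])
    fix v assume "v \<in> K"
    then have "deg_in r V v > card V" using deg' sub(1)[OF K(1)] by auto
    \<comment> \<open>At most \<open>card V - card K\<close> of the at least
      \<open>card V + 1\<close> arcs at \<open>v\<close> leave the component.\<close>
    then show "card K + 1 \<le> deg_in r K v"
      using deg_in_component[OF assms(1) K(1) \<open>v \<in> K\<close>] fK(2) by linarith
  qed (use assms K in auto)
  then show ?thesis using sub(1)[OF K(1)] by blast
qed

section \<open>Containment of directed cycles\<close>

lemma dcycle_nth:
  assumes "dcycle r xs" "length xs \<ge> 2" "i < length xs"
  shows "(xs ! i, xs ! (Suc i mod length xs)) \<in> r"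
proof (cases "Suc i < length xs")
  case True
  then have "(xs ! i, xs ! Suc i) \<in> r"
    using assms(1) successively_nth[of "\<lambda>u v. (u, v) \<in> r" xs i] by (simp add: dcycle_def dpath_def)
  then show ?thesis using True by simp
next
  case False
  then have i: "Suc i = length xs" using assms(3) by simp
  then have "xs \<noteq> []" "i = length xs - 1" by auto
  then have "xs ! i = last xs" "xs ! 0 = hd xs" by (simp_all add: last_conv_nth hd_conv_nth)
  then show ?thesis using assms(1,2) i by (simp add: dcycle_def)
qed

section \<open>Cyclic enumeration of a directed cycle and its embedding\<close>

lemma (in pre_digraph) awalk_verts_eq_tails: "cas u p w \<Longrightarrow> awalk_verts u p = map (tail G) p @ [w]"
  by (induction p arbitrary: u) auto

lemma (in pre_digraph) cas_head_nth:
  "cas u p w \<Longrightarrow> i < length p \<Longrightarrow>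
    head G (p ! i) = (if Suc i < length p then tail G (p ! Suc i) else w)"
proof (induction p arbitrary: u i)
  case (Cons e p)
  have "tail G (p ! 0) = head G e" if "p \<noteq> []" using Cons.prems(1) that by (cases p) auto
  moreover have "w = head G e" if "p = []" using Cons.prems(1) that by auto
  ultimately show ?case using Cons by (cases i) auto
qed simp

lemma directed_cycleE:
  assumes "directed_cycle C"
  obtains p where "arcs C = set p" "verts C = tail C ` set p" "distinct (map (tail C) p)"
    "length p = card (verts C)"
    "\<And>i. i < length p \<Longrightarrow> head C (p ! i) = tail C (p ! (Suc i mod length p))"
proof -
  obtain p where p: "pre_digraph.cycle C p" "arcs C = set p" "verts C = tail C ` set p"
    using assms by (auto simp: directed_cycle_def)
  obtain u where u: "pre_digraph.cas C u p u" "distinct (tl (pre_digraph.awalk_verts C u p))" "p \<noteq> []"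
    using p(1) by (auto simp: pre_digraph.cycle_def pre_digraph.awalk_def)
  have hd: "tail C (p ! 0) = u" using u(1,3) by (cases p) (auto simp: pre_digraph.cas.simps)
  \<comment> \<open>Distinctness is given for the walk without its first vertex \<open>u\<close>;
    since \<open>u\<close> comes back as the last vertex, this list is a rotation of the
    tails.\<close>
  have dist: "distinct (map (tail C) p)"
    using u(2,3) hd unfolding pre_digraph.awalk_verts_eq_tails[OF u(1)] by (cases p) auto
  then have "length p = card (verts C)"
    using p(3) distinct_card[OF dist] by simp
  moreover have "head C (p ! i) = tail C (p ! (Suc i mod length p))" if "i < length p" for i
    using pre_digraph.cas_head_nth[OF u(1) that] hd that by (auto simp: mod_Suc)
  ultimately show ?thesis using that p dist by blast
qed

text \<open>The tail of the i-th arc of \<open>C\<close> is sent to \<open>xs ! i\<close>. Indices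
  taken modulo the length turn the arcs of \<open>C\<close> into the arcs of \<open>xs\<close>,
  including the closing one.\<close>

lemma contains_digraph_directed_cycle:
  assumes C: "directed_cycle C" and "wf_digraph G"
    and xs: "dcycle (arcs_ends G) xs" "set xs \<subseteq> verts G" "length xs = card (verts C)"
  shows "contains_digraph G C"
proof -
  obtain p where p: "arcs C = set p" "verts C = tail C ` set p" "distinct (map (tail C) p)"
    "length p = card (verts C)"
    "\<And>i. i < length p \<Longrightarrow> head C (p ! i) = tail C (p ! (Suc i mod length p))"
    using directed_cycleE[OF C] by blast
  have len: "length p = length xs" "length xs \<ge> 2" and "wf_digraph C"
    using C p(4) xs(3) by (auto simp: directed_cycle_def digraph_def fin_digraph_def)
  have dist: "distinct xs" using xs(1) by (simp add: dcycle_def dpath_def)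
  have "\<exists>f. \<forall>i<length p. f (tail C (p ! i)) = xs ! i"
  proof -
    have "inj_on (\<lambda>i. tail C (p ! i)) {..<length p}"
      using p(3) by (auto simp: inj_on_def distinct_conv_nth)
    then show ?thesis
      by (intro exI[of _ "\<lambda>x. xs ! the_inv_into {..<length p} (\<lambda>i. tail C (p ! i)) x"])
        (simp add: the_inv_into_f_f[where A = "{..<length p}" and f = "\<lambda>i. tail C (p ! i)"])
  qed
  then obtain f where "\<forall>i<length p. f (tail C (p ! i)) = xs ! i" ..
  then have f: "f (tail C (p ! i)) = xs ! i" if "i < length p" for i using that by simp
  have arcE: "\<exists>e\<in>arcs G. tail G e = f (tail C a) \<and> head G e = f (head C a)" if a: "a \<in> arcs C" for a
  proof -
    obtain i where i: "i < length p" "a = p ! i" using a p(1) by (auto simp: in_set_conv_nth)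
    have "Suc i mod length p < length p" using len by (intro mod_less_divisor) linarith
    then have "f (tail C a) = xs ! i" "f (head C a) = xs ! (Suc i mod length xs)"
      using p(5)[OF i(1)] f[OF i(1)] f[of "Suc i mod length p"] i(2) len(1) by simp_all
    moreover have "(xs ! i, xs ! (Suc i mod length xs)) \<in> arcs_ends G"
      using dcycle_nth[OF xs(1) len(2)] i len by simp
    ultimately show ?thesis by (auto simp: arcs_ends_conv)
  qed
  then obtain g where g: "\<And>a. a \<in> arcs C \<Longrightarrow> g a \<in> arcs G \<and> tail G (g a) = f (tail C a) \<and> head G (g a) = f (head C a)"
    by metis
  have vC: "verts C = (\<lambda>i. tail C (p ! i)) ` {..<length p}"
  proof -
    have "set p = (!) p ` {..<length p}" by (auto simp: in_set_conv_nth)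
    then show ?thesis by (simp only: p(2) image_image)
  qed
  have inj_f: "inj_on f (verts C)"
    unfolding vC using f dist len by (auto simp: inj_on_def nth_eq_iff_index_eq)
  \<comment> \<open>An arc of a directed cycle is determined by its tail.\<close>
  have inj_g: "inj_on g (arcs C)"
  proof (rule inj_onI)
    fix a b assume ab: "a \<in> arcs C" "b \<in> arcs C" "g a = g b"
    then have "f (tail C a) = f (tail C b)" using g by metis
    then have "tail C a = tail C b" using inj_f ab p(1,2) by (auto simp: inj_on_def)
    then show "a = b" using p(1,3) ab by (auto simp: distinct_map inj_on_def)
  qed
  \<comment> \<open>Head and tail functions are taken from \<open>G\<close>, so that the copy is
    compatible with \<open>G\<close> as a subgraph.\<close>
  define h where "h = \<lparr>iso_verts = f, iso_arcs = g, iso_head = head G, iso_tail = tail G\<rparr>"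
  have iso: "pre_digraph.digraph_isomorphism C h"
    using \<open>wf_digraph C\<close> inj_f inj_g g by (simp add: pre_digraph.digraph_isomorphism_def h_def)
  have "f ` verts C \<subseteq> verts G" using vC f len xs(2) by auto
  then have "subgraph (app_iso h C) G"
    using g \<open>wf_digraph G\<close> wf_digraph.wf_digraphI_app_iso[OF \<open>wf_digraph C\<close> iso]
    by (auto simp: subgraph_def compatible_def h_def)
  then show ?thesis using iso by (auto simp: contains_digraph_def digraph_iso_def)
qed

text \<open>Without parallel arcs, counting arcs at \<open>v\<close> amounts to counting their other
  ends.\<close>

lemma (in digraph) degree_eq_deg_in:
  "in_degree G v + out_degree G v = deg_in (arcs_ends G) (verts G) v"
proof -
  have inj: "a = b" if "a \<in> arcs G" "b \<in> arcs G" "tail G a = tail G b" "head G a = head G b" for a b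
    using no_multi_arcs[of a b] that by (auto simp: arc_to_ends_def)
  have "{w \<in> verts G. (w, v) \<in> arcs_ends G} = tail G ` in_arcs G v"
    "{w \<in> verts G. (v, w) \<in> arcs_ends G} = head G ` out_arcs G v"
    by (auto simp: arcs_ends_conv in_arcs_def out_arcs_def)
  moreover have "inj_on (tail G) (in_arcs G v)" "inj_on (head G) (out_arcs G v)"
    using inj by (auto simp: inj_on_def in_arcs_def out_arcs_def)
  ultimately show ?thesis by (simp add: deg_in_def in_degree_def out_degree_def card_image)
qed

lemma contains_long_cycle:
  assumes "digraph G" "verts G \<noteq> {}" "directed_cycle C" "k \<ge> 1"
    and le: "int (card (verts C)) \<le> \<lceil>real (card (verts G)) / real k\<rceil>"
    and deg: "real (min_degree G) \<ge> (1 + 1 / real (k + 1)) * real (card (verts G))"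
  shows "contains_digraph G C"
proof -
  interpret digraph G by fact
  have "\<exists>xs. dcycle (arcs_ends G) xs \<and> length xs = card (verts C) \<and> set xs \<subseteq> verts G"
  proof (rule dcycle_of_large_degree)
    show "(v, v) \<notin> arcs_ends G" for v using no_loops by (auto simp: arcs_ends_conv)
    fix v assume "v \<in> verts G"
    then have "min_degree G \<le> deg_in (arcs_ends G) (verts G) v"
      unfolding min_degree_def degree_eq_deg_in by (intro Min_le) auto
    then have "(1 + 1 / real (k + 1)) * real (card (verts G)) \<le> real (deg_in (arcs_ends G) (verts G) v)"
      using deg by linarith
    then have "real (k + 1) * ((1 + 1 / real (k + 1)) * real (card (verts G)))
        \<le> real (k + 1) * real (deg_in (arcs_ends G) (verts G) v)"
      by (intro mult_left_mono) auto
    moreover have "real (k + 1) * ((1 + 1 / real (k + 1)) * real (card (verts G))) = real ((k + 2) * card (verts G))"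
      by (simp add: field_simps)
    ultimately show "(k + 2) * card (verts G) \<le> (k + 1) * deg_in (arcs_ends G) (verts G) v"
      by (metis of_nat_le_iff of_nat_mult)
  next
    fix m assume "card (verts G) \<le> k * m"
    \<comment> \<open>An integer \<open>m\<close> that is at least n/k is at least its ceiling,
      hence at least the length of \<open>C\<close>.\<close>
    then have "real (card (verts G)) \<le> real k * real m" by (metis of_nat_le_iff of_nat_mult)
    then have "real (card (verts G)) / real k \<le> real m" using assms(4) by (simp add: field_simps)
    then show "card (verts C) \<le> m" using le by linarith
  qed (use assms in \<open>auto simp: directed_cycle_def\<close>)
  then show ?thesis using contains_digraph_directed_cycle assms(3) wf_digraph_axioms by blast
qed

section \<open>The extremal digraph\<close>

lemma card_residue_class:
  assumes "c < m"
  shows "card {v. v < n \<and> v mod m = c} = card {q. q * m + c < (n::nat)}"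
proof -
  have "{v. v < n \<and> v mod m = c} = (\<lambda>q. q * m + c) ` {q. q * m + c < n}"
  proof (intro set_eqI iffI)
    fix v assume "v \<in> {v. v < n \<and> v mod m = c}"
    then have "v < n" and v: "v div m * m + c = v" by auto
    then have "v div m \<in> {q. q * m + c < n}" by simp
    then show "v \<in> (\<lambda>q. q * m + c) ` {q. q * m + c < n}" by (rule rev_image_eqI) (rule v[symmetric])
  qed (use assms in auto)
  moreover have "inj_on (\<lambda>q. q * m + c) {q. q * m + c < n}" using assms by (auto simp: inj_on_def)
  ultimately show ?thesis by (simp add: card_image)
qed

lemma finite_residue_quotients:
  assumes "c < m" shows "finite {q. q * m + c < (n::nat)}"
proof (rule finite_subset)
  show "{q. q * m + c < n} \<subseteq> {..<n}"
  proof safe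
    fix q assume "q * m + c < n"
    moreover have "q * 1 \<le> q * m" using assms by (intro mult_left_mono) auto
    ultimately show "q < n" by linarith
  qed
qed simp

text \<open>Each of the \<open>n div m\<close> complete blocks of \<open>m\<close> consecutive
  numbers contains every residue once.\<close>

lemma card_residue_class_ge:
  assumes "c < m" shows "n div m \<le> card {v. v < n \<and> v mod m = c}"
proof -
  have "{..<n div m} \<subseteq> {q. q * m + c < n}"
  proof safe
    fix q assume "q < n div m"
    then have "Suc q * m \<le> n div m * m" by (intro mult_right_mono) auto
    also have "\<dots> \<le> n" by simp
    finally show "q * m + c < n" using assms by simp
  qed
  then show ?thesis
    unfolding card_residue_class[OF assms]
    using card_mono[OF finite_residue_quotients[OF assms]] by (metis card_lessThan)
qed

text \<open>The residue \<open>m - 1\<close> ends a block, so it occurs in complete blocks only;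
  this class is a smallest one.\<close>

lemma card_residue_class_last:
  assumes "m > 0" shows "card {v. v < n \<and> v mod m = m - 1} = n div m"
proof -
  have "q * m + (m - 1) < n \<longleftrightarrow> q < n div m" for q
  proof -
    have "q * m + (m - 1) < n \<longleftrightarrow> Suc q * m \<le> n" using assms by auto
    also have "\<dots> \<longleftrightarrow> Suc q \<le> n div m" using assms by (simp only: less_eq_div_iff_mult_less_eq)
    finally show ?thesis by auto
  qed
  then have "{q. q * m + (m - 1) < n} = {..<n div m}" by auto
  moreover have "m - 1 < m" using assms by simp
  ultimately show ?thesis using card_residue_class[of "m - 1" m n] by simp
qed

lemma card_residue_class_le:
  assumes "c < m" shows "int (card {v. v < n \<and> v mod m = c}) \<le> \<lceil>real n / real m\<rceil>"
proof -
  have "{q. q * m + c < n} \<subseteq> {..<nat \<lceil>real n / real m\<rceil>}"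
  proof safe
    fix q assume "q * m + c < n"
    then have "real (q * m) < real n" by linarith
    then have "real q < real n / real m" using assms by (simp add: field_simps)
    then show "q < nat \<lceil>real n / real m\<rceil>" by linarith
  qed
  then have "card {q. q * m + c < n} \<le> nat \<lceil>real n / real m\<rceil>"
    using card_mono[OF finite_lessThan] by (metis card_lessThan)
  moreover have "real n / real m \<ge> 0" by simp
  ultimately show ?thesis unfolding card_residue_class[OF assms] by linarith
qed

text \<open>Arcs are pairs of ends, which rules out parallel arcs. Equal residues give arcs in both
  directions.\<close>

definition layered_digraph :: "nat \<Rightarrow> nat \<Rightarrow> (nat, nat \<times> nat) pre_digraph" where
  "layered_digraph m n = \<lparr>verts = {..<n},
     arcs = {(u, v). u < n \<and> v < n \<and> u \<noteq> v \<and> u mod m \<le> v mod m}, tail = fst, head = snd\<rparr>"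

lemma digraph_layered: "digraph (layered_digraph m n)"
proof
  show "finite (arcs (layered_digraph m n))"
    by (rule finite_subset[of _ "{..<n} \<times> {..<n}"]) (auto simp: layered_digraph_def)
qed (auto simp: layered_digraph_def arc_to_ends_def)

text \<open>Residues are totally ordered, so every other vertex is joined to \<open>v\<close>, and
  exactly those of its own class are joined twice. The 2 on the left accounts for \<open>v\<close>
  itself, removed from both counts.\<close>

lemma degree_layered:
  assumes "v < n"
  shows "in_degree (layered_digraph m n) v + out_degree (layered_digraph m n) v + 2
    = n + card {w. w < n \<and> w mod m = v mod m}"
proof -
  let ?G = "layered_digraph m n"
  define A B where "A = {w. w < n \<and> w \<noteq> v \<and> v mod m \<le> w mod m}"
    and "B = {w. w < n \<and> w \<noteq> v \<and> w mod m \<le> v mod m}"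
  have ends: "arcs_ends ?G = {(u, v). u < n \<and> v < n \<and> u \<noteq> v \<and> u mod m \<le> v mod m}" "verts ?G = {..<n}"
    by (auto simp: layered_digraph_def arcs_ends_conv)
  have "{w \<in> verts ?G. (v, w) \<in> arcs_ends ?G} = A" "{w \<in> verts ?G. (w, v) \<in> arcs_ends ?G} = B"
    using assms unfolding ends A_def B_def by auto
  then have "in_degree ?G v + out_degree ?G v = card A + card B"
    using digraph.degree_eq_deg_in[OF digraph_layered] by (simp add: deg_in_def)
  also have "\<dots> = card (A \<union> B) + card (A \<inter> B)"
    by (rule card_Un_Int) (auto simp: A_def B_def)
  also have "A \<union> B = {..<n} - {v}" by (auto simp: A_def B_def)
  also have "A \<inter> B = {w. w < n \<and> w mod m = v mod m} - {v}" by (auto simp: A_def B_def)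
  finally show ?thesis
    using assms card_Suc_Diff1[of "{w. w < n \<and> w mod m = v mod m}" v] by simp
qed

lemma min_degree_layered:
  assumes "m > 0" "n \<ge> m"
  shows "int (min_degree (layered_digraph m n)) = int n + \<lfloor>real n / real m\<rfloor> - 2"
proof -
  let ?G = "layered_digraph m n"
  let ?d = "\<lambda>v. in_degree ?G v + out_degree ?G v"
  have V: "verts ?G = {..<n}" by (simp add: layered_digraph_def)
  have "n div m \<ge> 1" using assms by (simp add: div_greater_zero_iff Suc_le_eq)
  have "min_degree ?G = n + n div m - 2"
    unfolding min_degree_def
  proof (rule Min_eqI)
    fix d assume "d \<in> ?d ` verts ?G"
    then obtain v where "v < n" "d = ?d v" by (auto simp: V)
    then show "n + n div m - 2 \<le> d"
      using degree_layered[of v n m] card_residue_class_ge[of "v mod m" m n] assms by simp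
  next
    \<comment> \<open>The minimum is attained at \<open>m - 1\<close>, which is a vertex because
      \<open>n \<ge> m\<close> and lies in a smallest class.\<close>
    have "?d (m - 1) + 2 = n + n div m"
      using degree_layered[of "m - 1" n m] card_residue_class_last[of m n] assms by simp
    then have "?d (m - 1) = n + n div m - 2" by simp
    then show "n + n div m - 2 \<in> ?d ` verts ?G" using assms by (auto simp: V intro!: image_eqI[of _ _ "m - 1"])
  qed (simp add: V)
  moreover have "\<lfloor>real n / real m\<rfloor> = int (n div m)" by (rule floor_divide_of_nat_eq)
  ultimately show ?thesis using \<open>n div m \<ge> 1\<close> assms by linarith
qed

text \<open>Residues weakly increase along arcs, so around a cycle they are constant. A copy of
  \<open>C\<close> would fit into one residue class, which has at most ceiling of n/m
  elements.\<close>

lemma layered_not_contains: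
  assumes C: "directed_cycle C" and "m > 0" and large: "\<lceil>real n / real m\<rceil> < int (card (verts C))"
  shows "\<not> contains_digraph (layered_digraph m n) C"
proof
  let ?G = "layered_digraph m n"
  assume "contains_digraph ?G C"
  then obtain h where h: "subgraph (app_iso h C) ?G" "pre_digraph.digraph_isomorphism C h"
    by (auto simp: contains_digraph_def digraph_iso_def)
  obtain p where p: "arcs C = set p" "verts C = tail C ` set p" "distinct (map (tail C) p)"
    "length p = card (verts C)"
    "\<And>i. i < length p \<Longrightarrow> head C (p ! i) = tail C (p ! (Suc i mod length p))"
    using directed_cycleE[OF C] by blast
  define l where "l = length p"
  define f where "f i = iso_verts h (tail C (p ! i))" for i
  have step: "f i mod m \<le> f (Suc i mod l) mod m" if "i < l" for i
  proof -
    have "p ! i \<in> arcs C" using that p(1) by (simp add: l_def)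
    then have "iso_arcs h (p ! i) \<in> arcs ?G"
      "iso_tail h (iso_arcs h (p ! i)) = f i" "iso_head h (iso_arcs h (p ! i)) = f (Suc i mod l)"
      using h p(5) that by (auto simp: subgraph_def pre_digraph.digraph_isomorphism_def l_def f_def)
    moreover have "iso_tail h = fst" "iso_head h = snd"
      using h(1) by (auto simp: subgraph_def compatible_def layered_digraph_def)
    ultimately show ?thesis by (auto simp: layered_digraph_def)
  qed
  have mono: "f i mod m \<le> f j mod m" if "i \<le> j" "j < l" for i j
    using that
  proof (induction j)
    case (Suc j)
    then show ?case using step[of j] by (cases "i = Suc j") auto
  qed simp
  have l: "l > 0" using C p(4) by (simp add: directed_cycle_def l_def)
  have const: "f i mod m = f 0 mod m" if "i < l" for i
  proof (rule antisym)
    have "f i mod m \<le> f (l - 1) mod m" using that by (intro mono) auto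
    also have "\<dots> \<le> f 0 mod m" using step[of "l - 1"] l by simp
    finally show "f i mod m \<le> f 0 mod m" .
  qed (use mono[of 0 i] that in simp)
  have "iso_verts h ` verts C \<subseteq> {v. v < n \<and> v mod m = f 0 mod m}"
  proof safe
    fix x assume x: "x \<in> verts C"
    then obtain i where "i < l" "x = tail C (p ! i)" by (auto simp: p(2) l_def in_set_conv_nth)
    then show "iso_verts h x mod m = f 0 mod m" using const[of i] by (simp add: f_def)
    show "iso_verts h x < n" using h(1) x by (auto simp: subgraph_def layered_digraph_def)
  qed
  then have "card (iso_verts h ` verts C) \<le> card {v. v < n \<and> v mod m = f 0 mod m}"
    by (intro card_mono) auto
  moreover have "card (iso_verts h ` verts C) = card (verts C)"
    using h(2) by (simp add: pre_digraph.digraph_isomorphism_def card_image)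
  ultimately show False using card_residue_class_le[of "f 0 mod m" m n] assms(2) large by simp
qed

section \<open>The degree threshold and its sharpness\<close>

theorem corollary1p8:
  fixes k :: nat
  assumes "k \<ge> 1"
  shows "(\<forall>\<gamma>::real. \<gamma> > 0 \<longrightarrow>
      (\<exists>n\<^sub>0::nat. n\<^sub>0 \<ge> 1 \<and>
        (\<forall>n\<ge>n\<^sub>0. \<forall>(C :: ('c, 'd) pre_digraph) (G :: ('a, 'b) pre_digraph).
          directed_cycle C \<longrightarrow>
          \<lceil>real n / real (k + 1)\<rceil> < int (card (verts C)) \<longrightarrow>
          int (card (verts C)) \<le> \<lceil>real n / real k\<rceil> \<longrightarrow>
          digraph G \<longrightarrow> card (verts G) = n \<longrightarrow>
          real (min_degree G) \<ge> (1 + 1 / real (k + 1) + \<gamma>) * real n \<longrightarrow>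
          contains_digraph G C)))
    \<and> (\<forall>n\<ge>k + 1. \<forall>C :: ('c, 'd) pre_digraph.
          directed_cycle C \<longrightarrow>
          \<lceil>real n / real (k + 1)\<rceil> < int (card (verts C)) \<longrightarrow>
          int (card (verts C)) \<le> \<lceil>real n / real k\<rceil> \<longrightarrow>
          (\<exists>G\<^sub>1 :: (nat, nat \<times> nat) pre_digraph.
            digraph G\<^sub>1 \<and> card (verts G\<^sub>1) = n \<and>
            int (min_degree G\<^sub>1) = int n + \<lfloor>real n / real (k + 1)\<rfloor> - 2 \<and>
            \<not> contains_digraph G\<^sub>1 C))"
proof (intro conjI allI impI)
  fix \<gamma> :: real assume "\<gamma> > 0"
  show "\<exists>n\<^sub>0::nat. n\<^sub>0 \<ge> 1 \<and>
        (\<forall>n\<ge>n\<^sub>0. \<forall>(C :: ('c, 'd) pre_digraph) (G :: ('a, 'b) pre_digraph).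
          directed_cycle C \<longrightarrow>
          \<lceil>real n / real (k + 1)\<rceil> < int (card (verts C)) \<longrightarrow>
          int (card (verts C)) \<le> \<lceil>real n / real k\<rceil> \<longrightarrow>
          digraph G \<longrightarrow> card (verts G) = n \<longrightarrow>
          real (min_degree G) \<ge> (1 + 1 / real (k + 1) + \<gamma>) * real n \<longrightarrow>
          contains_digraph G C)"
  proof (intro exI[of _ "1::nat"] conjI allI impI)
    fix n and C :: "('c, 'd) pre_digraph" and G :: "('a, 'b) pre_digraph"
    assume *: "1 \<le> n" "directed_cycle C" "int (card (verts C)) \<le> \<lceil>real n / real k\<rceil>" "digraph G"
      "card (verts G) = n" "(1 + 1 / real (k + 1) + \<gamma>) * real n \<le> real (min_degree G)"
    \<comment> \<open>The assumed bound implies the one without \<gamma>, which yields the cycle for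
      every nonempty vertex set; hence the witness \<open>1\<close>.\<close>
    have "(1 + 1 / real (k + 1)) * real n \<le> (1 + 1 / real (k + 1) + \<gamma>) * real n"
      using \<open>\<gamma> > 0\<close> by (intro mult_right_mono) auto
    then have "(1 + 1 / real (k + 1)) * real n \<le> real (min_degree G)" using *(6) by (rule order_trans)
    moreover have "verts G \<noteq> {}" using *(1,5) by auto
    ultimately show "contains_digraph G C"
      using * assms by (intro contains_long_cycle[of G C k]) simp_all
  qed simp
next
  fix n and C :: "('c, 'd) pre_digraph"
  assume "k + 1 \<le> n" "directed_cycle C" "\<lceil>real n / real (k + 1)\<rceil> < int (card (verts C))"
  then show "\<exists>G\<^sub>1 :: (nat, nat \<times> nat) pre_digraph.
            digraph G\<^sub>1 \<and> card (verts G\<^sub>1) = n \<and>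
            int (min_degree G\<^sub>1) = int n + \<lfloor>real n / real (k + 1)\<rfloor> - 2 \<and>
            \<not> contains_digraph G\<^sub>1 C"
    using digraph_layered[of "k + 1" n] min_degree_layered[of "k + 1" n] layered_not_contains[of C "k + 1" n]
    by (intro exI[of _ "layered_digraph (k + 1) n"]) (auto simp: layered_digraph_def)
qed

end
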